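(* Let $M,N$ be Polish spaces, let $D \subseteq M \times N$ be a compact set and let $c : M \times N \to \mathbb{R} \cup \{ + \infty\}$ be a cost function of class $\mathcal{C}^1$ on $D$. Let $\mu \in \mathcal{P}(M)$ and $\nu_0,\nu_1 \in \mathcal{P}(N)$. Assume that for $i=0,1$ there exists an optimal transport map $T_i$ from $\mu$ to $\nu_i$ for the cost $c$, with associated potential $\psi_i : N \to \mathbb{R}$, such that: (1) $\psi_0$ is Lipschitz on $N$ and $c$-concave on $D$; (2) $\psi_1$ is Lipschitz on $N$ and strongly $c$-concave with modulus $\omega$ on $D$; (3) for $i=0,1$ and for every $x \in M$, $(x,T_i(x)) \in D$. Then $$\int_M \omega\big(d_N(T_0 (x), T_1(x))\big)\, d\mu(x) \leq (\mathrm{Lip}(\psi_0) + \mathrm{Lip}(\psi_1))\, W_1(\nu_0, \nu_1).$$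
   Context: $\mathcal{P}(X)$ is the set of Borel probability measures on $X$; $d_N$ is the distance on $N$; $\mathrm{Lip}(\psi)$ is the Lipschitz constant of $\psi$; $W_1$ is the $1$-Wasserstein distance on $\mathcal{P}(N)$ associated with $d_N$. The cost $c$ is lower semi-continuous and bounded below. The assumption that $c$ is of class $\mathcal{C}^1$ on $D$ presupposes differentiable structures on $M$ and $N$ for which it makes sense. A transport map from $\mu$ to $\nu$ is a measurable map $T:M\to N$ with $T_\#\mu=\nu$; it is optimal if it minimizes $\int_M c(x,T(x))\,d\mu(x)$ among such maps. A function $\psi:N\to\mathbb{R}$ is a potential associated to $T$ (equivalently, $T$ is induced by $\psi$) if $T(x)\in \operatorname{argmin}_{y\in N}\, c(x,y)-\psi(y)$ for every $x\in M$. The $c$-superdifferential of $\psi$ at $y\in N$ is $\partial^c \psi(y) = \{x \in M \mid \forall z \in N,\ \psi(z) - c(x,z) \leq \psi(y) - c(x,y)\}$, and $\psi$ is $c$-concave if for every $y\in N$ there is $x\in M$ with $c(x,z)-\psi(z)\geq c(x,y)-\psi(y)$ for all $z\in N$, i.e. if $\partial^c\psi(y)\neq\emptyset$ for every $y\in N$. A modulus is an increasing function $\omega:\mathbb{R}_+\to\mathbb{R}_+$ with $\omega(0)=0$. A $c$-concave function $\psi$ is strongly $c$-concave on $D$ with modulus $\omega$ if for all $x,y,z$ such that $(x,y) \in D$, $(x,z) \in D$ and $x \in \partial^c \psi(y)$ one has $\psi(z) - c(x,z) \leq \psi(y) - c(x, y) - \omega(d_N(y,z))$. "$c$-concave on $D$"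 is read as the same condition with $\omega$ replaced by $0$: $\psi$ is $c$-concave and $\psi(z) - c(x,z) \leq \psi(y) - c(x, y)$ for all such $x,y,z$ (the inequality being then automatic). *)

theory Defs
  imports "HOL-Probability.Probability"
begin

section \<open>Functions of class C1\<close>

text \<open>
  On an arbitrary subset \<open>S\<close> of a normed space, class C1 means that \<open>f\<close> agrees on \<open>S\<close>, near each
  point of \<open>S\<close>, with a continuously differentiable function defined on an open neighbourhood of
  that point. For open \<open>S\<close> this is the usual notion, and it is implied by \<open>f\<close> being C1 on some
  open set containing \<open>S\<close>.
\<close>

definition C1_on :: "('a::real_normed_vector \<Rightarrow> 'b::real_normed_vector) \<Rightarrow> 'a set \<Rightarrow> bool" where
  "C1_on f S \<longleftrightarrow>
     (\<forall>x\<in>S. \<exists>U g g'. open U \<and> x \<in> U \<and>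
        (\<forall>u\<in>U. (g has_derivative blinfun_apply (g' u)) (at u)) \<and>
        continuous_on U g' \<and> (\<forall>u\<in>S \<inter> U. f u = g u))"

text \<open>
  A chart is a pair \<open>(U, \<phi>)\<close> of an open domain and a homeomorphism of \<open>U\<close> onto its image. The image
  is not required to be open in the model space, so that manifolds with boundary or corners and
  closed subsets of Euclidean space are covered besides ordinary manifolds; the model space
  may be infinite-dimensional.
\<close>

definition C1_atlas ::
    "('m::topological_space set \<times> ('m \<Rightarrow> 'e::real_normed_vector)) set \<Rightarrow> bool" where
  "C1_atlas \<A> \<longleftrightarrow>
     (\<forall>(U, \<phi>)\<in>\<A>. open U \<and> homeomorphism U (\<phi> ` U) \<phi> (inv_into U \<phi>)) \<and>
     \<Union>(fst ` \<A>) = UNIV \<and>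
     (\<forall>(U, \<phi>)\<in>\<A>. \<forall>(V, \<eta>)\<in>\<A>. C1_on (\<eta> \<circ> inv_into U \<phi>) (\<phi> ` (U \<inter> V)))"

definition cost_C1_on ::
    "('m::topological_space set \<times> ('m \<Rightarrow> 'e::real_normed_vector)) set \<Rightarrow>
     ('n::topological_space set \<times> ('n \<Rightarrow> 'f::real_normed_vector)) set \<Rightarrow>
     ('m \<times> 'n \<Rightarrow> ereal) \<Rightarrow> ('m \<times> 'n) set \<Rightarrow> bool" where
  "cost_C1_on \<A> \<B> c D \<longleftrightarrow>
     (\<forall>p\<in>D. \<bar>c p\<bar> \<noteq> \<infinity>) \<and>
     (\<forall>(U, \<phi>)\<in>\<A>. \<forall>(V, \<eta>)\<in>\<B>.
        C1_on (real_of_ereal \<circ> c \<circ> map_prod (inv_into U \<phi>) (inv_into V \<eta>))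
              (map_prod \<phi> \<eta> ` (D \<inter> U \<times> V)))"

section \<open>Optimal transport\<close>

definition lower_semicontinuous :: "('a::topological_space \<Rightarrow> ereal) \<Rightarrow> bool" where
  "lower_semicontinuous f \<longleftrightarrow> (\<forall>x. f x \<le> Liminf (at x) f)"

definition borel_prob :: "'a::topological_space measure set" where
  "borel_prob = {\<mu>. prob_space \<mu> \<and> sets \<mu> = sets borel}"

text \<open>
  The integral of an extended real-valued function as the difference of the integrals of its
  positive and negative parts (\<open>e2ennreal\<close> maps negative values to 0). It has its usual meaning as
  soon as one of the two is finite, in particular for functions that are bounded below and
  probability measures.
\<close>

definition ereal_integral :: "'a measure \<Rightarrow> ('a \<Rightarrow> ereal) \<Rightarrow> ereal" where
  "ereal_integral \<mu> f =
     enn2ereal (\<integral>\<^sup>+ x. e2ennreal (f x) \<partial>\<mu>) - enn2ereal (\<integral>\<^sup>+ x. e2ennreal (- f x) \<partial>\<mu>)"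

definition transport_map ::
    "'m::topological_space measure \<Rightarrow> 'n::topological_space measure \<Rightarrow> ('m \<Rightarrow> 'n) \<Rightarrow> bool" where
  "transport_map \<mu> \<nu> T \<longleftrightarrow> T \<in> measurable \<mu> borel \<and> distr \<mu> borel T = \<nu>"

definition optimal_transport_map ::
    "('m::topological_space \<times> 'n::topological_space \<Rightarrow> ereal) \<Rightarrow>
     'm measure \<Rightarrow> 'n measure \<Rightarrow> ('m \<Rightarrow> 'n) \<Rightarrow> bool" where
  "optimal_transport_map c \<mu> \<nu> T \<longleftrightarrow>
     is_arg_min (\<lambda>S. ereal_integral \<mu> (\<lambda>x. c (x, S x))) (transport_map \<mu> \<nu>) T"

definition potential_of :: "('m \<times> 'n \<Rightarrow> ereal) \<Rightarrow> ('m \<Rightarrow> 'n) \<Rightarrow> ('n \<Rightarrow> real) \<Rightarrow> bool" where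
  "potential_of c T \<psi> \<longleftrightarrow> (\<forall>x. is_arg_min (\<lambda>y. c (x, y) - ereal (\<psi> y)) (\<lambda>_. True) (T x))"

definition W1 :: "'n::metric_space measure \<Rightarrow> 'n measure \<Rightarrow> ennreal" where
  "W1 \<nu>\<^sub>0 \<nu>\<^sub>1 =
     (INF \<gamma>\<in>{\<gamma>\<in>borel_prob. distr \<gamma> borel fst = \<nu>\<^sub>0 \<and> distr \<gamma> borel snd = \<nu>\<^sub>1}.
        \<integral>\<^sup>+ (y, z). ennreal (dist y z) \<partial>\<gamma>)"

section \<open>Concavity with respect to a cost\<close>

definition c_superdiff :: "('m \<times> 'n \<Rightarrow> ereal) \<Rightarrow> ('n \<Rightarrow> real) \<Rightarrow> 'n \<Rightarrow> 'm set" where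
  "c_superdiff c \<psi> y = {x. \<forall>z. ereal (\<psi> z) - c (x, z) \<le> ereal (\<psi> y) - c (x, y)}"

definition c_concave :: "('m \<times> 'n \<Rightarrow> ereal) \<Rightarrow> ('n \<Rightarrow> real) \<Rightarrow> bool" where
  "c_concave c \<psi> \<longleftrightarrow> (\<forall>y. c_superdiff c \<psi> y \<noteq> {})"

text \<open>
  Functions on the nonnegative reals are represented by functions on all reals, whose values at
  negative arguments are irrelevant. ``Increasing'' is understood in the weak sense.
\<close>

definition modulus :: "(real \<Rightarrow> real) \<Rightarrow> bool" where
  "modulus \<omega> \<longleftrightarrow> \<omega> \<in> {0..} \<rightarrow> {0..} \<and> mono_on {0..} \<omega> \<and> \<omega> 0 = 0"

definition strongly_c_concave_on ::
    "('m \<times> 'n::metric_space \<Rightarrow> ereal) \<Rightarrow> ('m \<times> 'n) set \<Rightarrow> (real \<Rightarrow> real) \<Rightarrow> ('n \<Rightarrow> real) \<Rightarrow> bool"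
  where
  "strongly_c_concave_on c D \<omega> \<psi> \<longleftrightarrow>
     c_concave c \<psi> \<and>
     (\<forall>x y z. (x, y) \<in> D \<longrightarrow> (x, z) \<in> D \<longrightarrow> x \<in> c_superdiff c \<psi> y \<longrightarrow>
        ereal (\<psi> z) - c (x, z) \<le> ereal (\<psi> y) - c (x, y) - ereal (\<omega> (dist y z)))"

definition c_concave_on ::
    "('m \<times> 'n::metric_space \<Rightarrow> ereal) \<Rightarrow> ('m \<times> 'n) set \<Rightarrow> ('n \<Rightarrow> real) \<Rightarrow> bool" where
  "c_concave_on c D \<psi> \<longleftrightarrow> strongly_c_concave_on c D (\<lambda>_. 0) \<psi>"

definition Lip :: "('n::metric_space \<Rightarrow> real) \<Rightarrow> real" where
  "Lip \<psi> = Inf {L. L-lipschitz_on UNIV \<psi>}"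

end

theory Submission
  imports Defs
begin

text \<open>
  Write \<open>\<phi> = \<psi>\<^sub>0 - \<psi>\<^sub>1\<close>. The potential \<open>\<psi>\<^sub>1\<close> makes \<open>T\<^sub>1 x\<close> a minimizer of \<open>c (x, \<cdot>) - \<psi>\<^sub>1\<close>, and strong
  concavity quantifies the loss of using \<open>T\<^sub>0 x\<close> instead: it is at least \<open>\<omega> (d (T\<^sub>0 x) (T\<^sub>1 x))\<close>.
  Conversely, using \<open>T\<^sub>1 x\<close> in place of the minimizer \<open>T\<^sub>0 x\<close> of \<open>c (x, \<cdot>) - \<psi>\<^sub>0\<close> costs at least
  nothing. When the two inequalities are added, the costs (finite on \<open>D\<close>) cancel, leaving
  \<open>\<omega> (d (T\<^sub>0 x) (T\<^sub>1 x)) \<le> \<phi> (T\<^sub>0 x) - \<phi> (T\<^sub>1 x)\<close> for every \<open>x\<close>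
  (\<open>modulus_le_potential_gap\<close>).

  Integrated against \<open>\<mu>\<close>, the right-hand side becomes \<open>\<integral>\<phi> d\<nu>\<^sub>0 - \<integral>\<phi> d\<nu>\<^sub>1\<close>, because \<open>T\<^sub>0\<close> and
  \<open>T\<^sub>1\<close> push \<open>\<mu>\<close> forward to \<open>\<nu>\<^sub>0\<close> and \<open>\<nu>\<^sub>1\<close>. Compactness of \<open>D\<close> makes the integrals finite, since
  both maps take their values in the compact projection of \<open>D\<close>. As \<open>\<phi>\<close> is Lipschitz with constant
  \<open>Lip \<psi>\<^sub>0 + Lip \<psi>\<^sub>1\<close>, the easy direction of Kantorovich--Rubinstein duality
  (\<open>integral_diff_le_W1\<close>) bounds that difference by the Wasserstein distance.
\<close>

text \<open>The infimum defining \<open>Lip\<close> is attained, since each defining inequality is closed in \<open>L\<close>.\<close>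

lemma lipschitz_on_Lip:
  assumes "\<exists>L. L-lipschitz_on UNIV f"
  shows "(Lip f)-lipschitz_on UNIV f"
proof (rule lipschitz_onI)
  let ?S = "{L. L-lipschitz_on UNIV f}"
  have ne: "?S \<noteq> {}"
    using assms by auto
  show "0 \<le> Lip f"
    unfolding Lip_def using ne by (intro cInf_greatest) (auto dest: lipschitz_on_nonneg)
  fix x y
  show "dist (f x) (f y) \<le> Lip f * dist x y"
  proof (cases "x = y")
    case False
    have "dist (f x) (f y) / dist x y \<le> Lip f"
      unfolding Lip_def using ne False
      by (intro cInf_greatest) (auto simp: divide_le_eq dest: lipschitz_onD)
    with False show ?thesis
      by (simp add: divide_le_eq)
  qed simp
qed

text \<open>
  For each coupling \<open>\<gamma>\<close>, both integrals are integrals over \<open>\<gamma>\<close>, and there the integrand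
  \<open>f y - f z\<close> is at most \<open>L * dist y z\<close>.
\<close>

lemma integral_diff_le_W1:
  fixes f :: "'n::polish_space \<Rightarrow> real"
  assumes prob: "\<nu>\<^sub>0 \<in> borel_prob" "\<nu>\<^sub>1 \<in> borel_prob"
    and L: "L-lipschitz_on UNIV f"
    and int: "integrable \<nu>\<^sub>0 f" "integrable \<nu>\<^sub>1 f"
  shows "ennreal (integral\<^sup>L \<nu>\<^sub>0 f - integral\<^sup>L \<nu>\<^sub>1 f) \<le> ennreal L * W1 \<nu>\<^sub>0 \<nu>\<^sub>1"
proof -
  have "L \<ge> 0"
    using L by (rule lipschitz_on_nonneg)
  have [measurable]: "f \<in> borel_measurable borel"
    using lipschitz_on_continuous_on[OF L] by (rule borel_measurable_continuous_onI)
  have coupling: "ennreal (integral\<^sup>L \<nu>\<^sub>0 f - integral\<^sup>L \<nu>\<^sub>1 f)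
      \<le> ennreal L * (\<integral>\<^sup>+ (y, z). ennreal (dist y z) \<partial>\<gamma>)"
    if \<gamma>: "\<gamma> \<in> borel_prob" "distr \<gamma> borel fst = \<nu>\<^sub>0" "distr \<gamma> borel snd = \<nu>\<^sub>1" for \<gamma>
  proof -
    have sets_\<gamma>: "sets \<gamma> = sets (borel :: ('n \<times> 'n) measure)"
      using \<gamma>(1) by (simp add: borel_prob_def)
    have [measurable]: "fst \<in> measurable \<gamma> borel" "snd \<in> measurable \<gamma> borel"
      by (auto simp: measurable_cong_sets[OF sets_\<gamma> refl]
          intro!: borel_measurable_continuous_onI continuous_intros)
    have int_fst: "integrable \<gamma> (\<lambda>p. f (fst p))" and int_snd: "integrable \<gamma> (\<lambda>p. f (snd p))"
      using int \<gamma>(2,3) by (auto simp: integrable_distr_eq)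
    have "integral\<^sup>L \<nu>\<^sub>0 f - integral\<^sup>L \<nu>\<^sub>1 f = (\<integral>p. f (fst p) \<partial>\<gamma>) - (\<integral>p. f (snd p) \<partial>\<gamma>)"
      by (simp flip: \<gamma>(2,3) add: integral_distr)
    also have "\<dots> = (\<integral>p. f (fst p) - f (snd p) \<partial>\<gamma>)"
      using int_fst int_snd by simp
    finally have "ennreal (integral\<^sup>L \<nu>\<^sub>0 f - integral\<^sup>L \<nu>\<^sub>1 f)
        \<le> ennreal (norm (\<integral>p. f (fst p) - f (snd p) \<partial>\<gamma>))"
      by (simp add: ennreal_leI)
    also have "\<dots> \<le> (\<integral>\<^sup>+ p. norm (f (fst p) - f (snd p)) \<partial>\<gamma>)"
      using int_fst int_snd by (intro integral_norm_bound_ennreal) simp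
    also have "\<dots> \<le> (\<integral>\<^sup>+ p. ennreal L * ennreal (dist (fst p) (snd p)) \<partial>\<gamma>)"
      using lipschitz_onD[OF L] \<open>L \<ge> 0\<close>
      by (intro nn_integral_mono) (auto simp flip: ennreal_mult simp: dist_real_def intro!: ennreal_leI)
    also have "\<dots> = ennreal L * (\<integral>\<^sup>+ p. ennreal (dist (fst p) (snd p)) \<partial>\<gamma>)"
      by (intro nn_integral_cmult) measurable
    finally show ?thesis
      by (simp add: case_prod_beta')
  qed
  show ?thesis
  proof (cases "L = 0")
    \<comment> \<open>The bound for couplings is carried over to their infimum by dividing by \<open>L\<close>; a Lipschitz
        constant \<open>0\<close> makes \<open>f\<close> constant, with the same integral against both probabilities.\<close>
    case True
    then have "f = (\<lambda>_. f undefined)"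
      using lipschitz_onD[OF L] by fastforce
    then obtain k where f: "f = (\<lambda>_. k)" ..
    interpret \<nu>\<^sub>0: prob_space \<nu>\<^sub>0 using prob by (simp add: borel_prob_def)
    interpret \<nu>\<^sub>1: prob_space \<nu>\<^sub>1 using prob by (simp add: borel_prob_def)
    show ?thesis
      by (simp add: f \<nu>\<^sub>0.prob_space \<nu>\<^sub>1.prob_space)
  next
    case False
    with \<open>L \<ge> 0\<close> have "L > 0" by simp
    let ?r = "integral\<^sup>L \<nu>\<^sub>0 f - integral\<^sup>L \<nu>\<^sub>1 f"
    have scale: "ennreal L * ennreal (?r / L) = ennreal ?r"
      using \<open>L > 0\<close> by (simp flip: ennreal_mult')
    have "ennreal (?r / L) \<le> W1 \<nu>\<^sub>0 \<nu>\<^sub>1"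
      unfolding W1_def
    proof (rule INF_greatest)
      fix \<gamma> assume "\<gamma> \<in> {\<gamma> \<in> borel_prob. distr \<gamma> borel fst = \<nu>\<^sub>0 \<and> distr \<gamma> borel snd = \<nu>\<^sub>1}"
      then show "ennreal (?r / L) \<le> (\<integral>\<^sup>+ (y, z). ennreal (dist y z) \<partial>\<gamma>)"
        using coupling[of \<gamma>, folded scale] \<open>L > 0\<close> by (simp add: ennreal_mult_le_mult_iff)
    qed
    then show ?thesis
      by (subst scale[symmetric]) (rule mult_left_mono, auto)
  qed
qed

text \<open>
  Membership in the superdifferential is the minimality of \<open>c (x, \<cdot>) - \<psi>\<close> with the sign reversed.
\<close>

lemma potential_of_imp_c_superdiff:
  assumes "potential_of c T \<psi>"
  shows "x \<in> c_superdiff c \<psi> (T x)"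
proof -
  have "ereal (\<psi> z) - c (x, z) \<le> ereal (\<psi> (T x)) - c (x, T x)" for z
  proof -
    have "c (x, T x) - ereal (\<psi> (T x)) \<le> c (x, z) - ereal (\<psi> z)"
      using assms by (auto simp: potential_of_def is_arg_min_def not_less)
    then show ?thesis
      by (cases "c (x, T x)"; cases "c (x, z)") auto
  qed
  then show ?thesis
    by (simp add: c_superdiff_def)
qed

text \<open>
  The sum of the optimality of \<open>y\<^sub>0\<close> for \<open>\<psi>\<^sub>0\<close> and the quantitative optimality of \<open>y\<^sub>1\<close> for \<open>\<psi>\<^sub>1\<close>;
  finiteness of the cost allows it to cancel.
\<close>

lemma modulus_le_potential_gap:
  assumes strong: "strongly_c_concave_on c D \<omega> \<psi>\<^sub>1"
    and D: "(x, y\<^sub>0) \<in> D" "(x, y\<^sub>1) \<in> D"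
    and finite: "\<bar>c (x, y\<^sub>0)\<bar> \<noteq> \<infinity>" "\<bar>c (x, y\<^sub>1)\<bar> \<noteq> \<infinity>"
    and superdiff: "x \<in> c_superdiff c \<psi>\<^sub>0 y\<^sub>0" "x \<in> c_superdiff c \<psi>\<^sub>1 y\<^sub>1"
  shows "\<omega> (dist y\<^sub>0 y\<^sub>1) \<le> (\<psi>\<^sub>0 y\<^sub>0 - \<psi>\<^sub>1 y\<^sub>0) - (\<psi>\<^sub>0 y\<^sub>1 - \<psi>\<^sub>1 y\<^sub>1)"
proof -
  obtain a b where ab: "c (x, y\<^sub>0) = ereal a" "c (x, y\<^sub>1) = ereal b"
    using finite by (metis ereal_infinity_cases ereal_real')
  have "ereal (\<psi>\<^sub>0 y\<^sub>1) - c (x, y\<^sub>1) \<le> ereal (\<psi>\<^sub>0 y\<^sub>0) - c (x, y\<^sub>0)"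
    using superdiff(1) by (simp add: c_superdiff_def)
  moreover have "ereal (\<psi>\<^sub>1 y\<^sub>0) - c (x, y\<^sub>0) \<le> ereal (\<psi>\<^sub>1 y\<^sub>1) - c (x, y\<^sub>1) - ereal (\<omega> (dist y\<^sub>1 y\<^sub>0))"
    using strong D superdiff(2) by (simp add: strongly_c_concave_on_def)
  ultimately show ?thesis
    by (simp add: ab dist_commute)
qed

lemma integrable_continuous_comp_compact:
  fixes f :: "'n::topological_space \<Rightarrow> real"
  assumes "finite_measure \<mu>" "continuous_on UNIV f" "T \<in> measurable \<mu> borel"
    and "compact K" "\<And>x. T x \<in> K"
  shows "integrable \<mu> (\<lambda>x. f (T x))"
proof -
  have "compact (f ` K)"
    using assms by (intro compact_continuous_image) (auto intro: continuous_on_subset)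
  then have "bounded (f ` K)"
    by (rule compact_imp_bounded)
  then obtain B where "\<forall>y\<in>K. norm (f y) \<le> B"
    unfolding bounded_iff by auto
  moreover have "(\<lambda>x. f (T x)) \<in> borel_measurable \<mu>"
    using assms(2,3) by (auto intro: measurable_compose borel_measurable_continuous_onI)
  ultimately show ?thesis
    using assms(1,5) by (intro finite_measure.integrable_const_bound[where B = B]) auto
qed

theorem theorem5:
  fixes \<A> :: "('m::polish_space set \<times> ('m \<Rightarrow> 'e::real_normed_vector)) set"
    and \<B> :: "('n::polish_space set \<times> ('n \<Rightarrow> 'f::real_normed_vector)) set"
    and D :: "('m \<times> 'n) set"
    and c :: "'m \<times> 'n \<Rightarrow> ereal"
    and \<mu> :: "'m measure"
    and \<nu>\<^sub>0 \<nu>\<^sub>1 :: "'n measure"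
    and T\<^sub>0 T\<^sub>1 :: "'m \<Rightarrow> 'n"
    and \<psi>\<^sub>0 \<psi>\<^sub>1 :: "'n \<Rightarrow> real"
    and \<omega> :: "real \<Rightarrow> real"
  assumes "C1_atlas \<A>" and "C1_atlas \<B>"
    and "compact D"
    and "lower_semicontinuous c" and "\<exists>b::real. \<forall>p. ereal b \<le> c p"
    and "cost_C1_on \<A> \<B> c D"
    and "\<mu> \<in> borel_prob" and "\<nu>\<^sub>0 \<in> borel_prob" and "\<nu>\<^sub>1 \<in> borel_prob"
    and "optimal_transport_map c \<mu> \<nu>\<^sub>0 T\<^sub>0" and "potential_of c T\<^sub>0 \<psi>\<^sub>0"
    and "optimal_transport_map c \<mu> \<nu>\<^sub>1 T\<^sub>1" and "potential_of c T\<^sub>1 \<psi>\<^sub>1"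
    and "\<exists>L. L-lipschitz_on UNIV \<psi>\<^sub>0" and "c_concave_on c D \<psi>\<^sub>0"
    and "modulus \<omega>"
    and "\<exists>L. L-lipschitz_on UNIV \<psi>\<^sub>1" and "strongly_c_concave_on c D \<omega> \<psi>\<^sub>1"
    and "\<forall>x. (x, T\<^sub>0 x) \<in> D" and "\<forall>x. (x, T\<^sub>1 x) \<in> D"
  shows "(\<integral>\<^sup>+ x. ennreal (\<omega> (dist (T\<^sub>0 x) (T\<^sub>1 x))) \<partial>\<mu>)
           \<le> ennreal (Lip \<psi>\<^sub>0 + Lip \<psi>\<^sub>1) * W1 \<nu>\<^sub>0 \<nu>\<^sub>1"
proof -
  define \<phi> where "\<phi> y = \<psi>\<^sub>0 y - \<psi>\<^sub>1 y" for y
  have lip: "(Lip \<psi>\<^sub>0 + Lip \<psi>\<^sub>1)-lipschitz_on UNIV \<phi>"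
    unfolding \<phi>_def using assms(14,17) by (intro lipschitz_on_diff lipschitz_on_Lip)
  then have cont: "continuous_on UNIV \<phi>"
    by (rule lipschitz_on_continuous_on)
  then have meas_\<phi>: "\<phi> \<in> borel_measurable borel"
    by (rule borel_measurable_continuous_onI)
  have T\<^sub>0: "T\<^sub>0 \<in> measurable \<mu> borel" "distr \<mu> borel T\<^sub>0 = \<nu>\<^sub>0"
    and T\<^sub>1: "T\<^sub>1 \<in> measurable \<mu> borel" "distr \<mu> borel T\<^sub>1 = \<nu>\<^sub>1"
    using assms(10,12) by (auto simp: optimal_transport_map_def is_arg_min_def transport_map_def)
  have "finite_measure \<mu>"
    using assms(7) by (simp add: borel_prob_def prob_space.finite_measure)
  moreover have "compact (snd ` D)"
    using assms(3) by (intro compact_continuous_image continuous_intros)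
  moreover have "T\<^sub>0 x \<in> snd ` D" "T\<^sub>1 x \<in> snd ` D" for x
    using assms(19,20) by force+
  ultimately have int: "integrable \<mu> (\<lambda>x. \<phi> (T\<^sub>0 x))" "integrable \<mu> (\<lambda>x. \<phi> (T\<^sub>1 x))"
    using cont T\<^sub>0(1) T\<^sub>1(1) integrable_continuous_comp_compact[of \<mu> \<phi> _ "snd ` D"] by simp_all
  have finite: "\<bar>c (x, T\<^sub>0 x)\<bar> \<noteq> \<infinity>" "\<bar>c (x, T\<^sub>1 x)\<bar> \<noteq> \<infinity>" for x
    using assms(6)[unfolded cost_C1_on_def, THEN conjunct1] assms(19,20) by (meson bspec)+
  have gap: "\<omega> (dist (T\<^sub>0 x) (T\<^sub>1 x)) \<le> \<phi> (T\<^sub>0 x) - \<phi> (T\<^sub>1 x)" for x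
    unfolding \<phi>_def
    using assms(18) assms(19,20)[rule_format] finite assms(11,13)[THEN potential_of_imp_c_superdiff]
    by (rule modulus_le_potential_gap)
  have "0 \<le> \<omega> (dist (T\<^sub>0 x) (T\<^sub>1 x))" for x
    using assms(16) by (auto simp: modulus_def Pi_iff)
  with gap have nonneg: "0 \<le> \<phi> (T\<^sub>0 x) - \<phi> (T\<^sub>1 x)" for x
    by (meson order_trans)
  have "(\<integral>\<^sup>+ x. ennreal (\<omega> (dist (T\<^sub>0 x) (T\<^sub>1 x))) \<partial>\<mu>) \<le> (\<integral>\<^sup>+ x. ennreal (\<phi> (T\<^sub>0 x) - \<phi> (T\<^sub>1 x)) \<partial>\<mu>)"
    by (intro nn_integral_mono ennreal_leI gap)
  also have "\<dots> = ennreal (\<integral>x. \<phi> (T\<^sub>0 x) - \<phi> (T\<^sub>1 x) \<partial>\<mu>)"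
    using int nonneg by (intro nn_integral_eq_integral) auto
  also have "(\<integral>x. \<phi> (T\<^sub>0 x) - \<phi> (T\<^sub>1 x) \<partial>\<mu>) = integral\<^sup>L \<nu>\<^sub>0 \<phi> - integral\<^sup>L \<nu>\<^sub>1 \<phi>"
    using int T\<^sub>0(1) T\<^sub>1(1) meas_\<phi> by (simp flip: T\<^sub>0(2) T\<^sub>1(2) add: integral_distr)
  also have "ennreal (integral\<^sup>L \<nu>\<^sub>0 \<phi> - integral\<^sup>L \<nu>\<^sub>1 \<phi>) \<le> ennreal (Lip \<psi>\<^sub>0 + Lip \<psi>\<^sub>1) * W1 \<nu>\<^sub>0 \<nu>\<^sub>1"
    using assms(8,9) lip
  proof (rule integral_diff_le_W1)
    show "integrable \<nu>\<^sub>0 \<phi>" "integrable \<nu>\<^sub>1 \<phi>"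
      using int T\<^sub>0(1) T\<^sub>1(1) meas_\<phi> by (simp_all flip: T\<^sub>0(2) T\<^sub>1(2) add: integrable_distr_eq)
  qed
  finally show ?thesis .
qed

end
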